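(* Let $k\geq 2$ and $n\geq (2k)^{9k^2}$ be integers and let $\varepsilon\in\left(0,\frac{1}{2000k^2}\right)$ be real. Let $G$ be a maximal $C_{2k+1}$-free graph on $n$ vertices with $e(G)=\frac{n^2}{4}-\varepsilon n^{3/2}$. Then $G$ contains an induced complete bipartite subgraph on at least $(1-250k^2\varepsilon)n$ vertices.
   Context: $C_{2k+1}$ denotes the cycle of length $2k+1$. A graph $G$ is maximal $C_{2k+1}$-free if it contains no subgraph isomorphic to $C_{2k+1}$ and adding any edge of the complement of $G$ to $G$ creates a copy of $C_{2k+1}$. $e(G)$ is the number of edges of $G$. Graphs are finite and simple. *)

theory Defs
  imports Complex_Main "HOL-Library.Ramsey"
begin

definition finite_simple_graph :: "'a set \<Rightarrow> 'a set set \<Rightarrow> bool" where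
  "finite_simple_graph V E \<longleftrightarrow> finite V \<and> E \<subseteq> [V]\<^bsup>2\<^esup>"

definition subgraph_of :: "'a set \<Rightarrow> 'a set set \<Rightarrow> 'a set \<Rightarrow> 'a set set \<Rightarrow> bool" where
  "subgraph_of W F V E \<longleftrightarrow> W \<subseteq> V \<and> F \<subseteq> E \<and> F \<subseteq> [W]\<^bsup>2\<^esup>"

definition graph_isomorphic :: "'a set \<Rightarrow> 'a set set \<Rightarrow> 'b set \<Rightarrow> 'b set set \<Rightarrow> bool" where
  "graph_isomorphic V E W F \<longleftrightarrow>
     (\<exists>f. bij_betw f V W \<and> (\<forall>u\<in>V. \<forall>v\<in>V. {u, v} \<in> E \<longleftrightarrow> {f u, f v} \<in> F))"

text \<open>The cycle of length \<open>m\<close> on the vertex set \<open>{..<m}\<close>; only meaningful for \<open>m \<ge> 3\<close>.\<close>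

definition cycle_edges :: "nat \<Rightarrow> nat set set" where
  "cycle_edges m = {{i, Suc i mod m} | i. i < m}"

definition contains_cycle :: "nat \<Rightarrow> 'a set \<Rightarrow> 'a set set \<Rightarrow> bool" where
  "contains_cycle m V E \<longleftrightarrow>
     (\<exists>W F. subgraph_of W F V E \<and> graph_isomorphic {..<m} (cycle_edges m) W F)"

definition maximal_cycle_free :: "nat \<Rightarrow> 'a set \<Rightarrow> 'a set set \<Rightarrow> bool" where
  "maximal_cycle_free m V E \<longleftrightarrow>
     \<not> contains_cycle m V E \<and>
     (\<forall>e \<in> [V]\<^bsup>2\<^esup> - E. contains_cycle m V (insert e E))"

definition induced_edges :: "'a set set \<Rightarrow> 'a set \<Rightarrow> 'a set set" where
  "induced_edges E W = {e \<in> E. e \<subseteq> W}"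

text \<open>Both parts of a complete bipartite graph are required to be nonempty, so that an
  independent set does not count as one.\<close>

definition complete_bipartite :: "'a set \<Rightarrow> 'a set set \<Rightarrow> bool" where
  "complete_bipartite W F \<longleftrightarrow>
     (\<exists>A B. A \<noteq> {} \<and> B \<noteq> {} \<and> A \<inter> B = {} \<and> A \<union> B = W \<and>
        F = {{a, b} | a b. a \<in> A \<and> b \<in> B})"

end

theory Submission
  imports Defs
begin

text \<open>
  Let \<open>S\<close> maximise \<open>e(S) - (49/200) |S|\<^sup>2\<close> over all sets of vertices. Deleting a vertex of \<open>S\<close>
  cannot increase this quantity, so \<open>G[S]\<close> has minimum degree almost \<open>|S|/2\<close>; being
  \<open>C\<^bsub>2k+1\<^esub>\<close>-free it is then bipartite, with parts \<open>A\<close> and \<open>B\<close>. Comparing \<open>S\<close> with the whole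
  vertex set shows that only \<open>O(\<epsilon> n\<^bsup>1/2\<^esup>)\<close> vertices lie outside \<open>S\<close> and that at most
  \<open>\<epsilon> n\<^bsup>3/2\<^esup>\<close> pairs of \<open>A \<times> B\<close> are not edges.

  By maximality a non-adjacent pair \<open>a \<in> A\<close>, \<open>b \<in> B\<close> is joined by a path of length \<open>2k\<close>. Since
  \<open>G[S]\<close> contains paths of all short lengths of the right parity, a piece of that path which leaves
  \<open>S\<close>, returns with the wrong parity and has length less than \<open>2k\<close> would close up to a
  \<open>C\<^bsub>2k+1\<^esub>\<close>; so all inner vertices of the path lie outside \<open>S\<close>. If \<open>t\<close> is the inner vertex next
  to \<open>b\<close>, then \<open>a\<close> has no neighbour in \<open>N(t) \<inter> B\<close>, as such a neighbour could replace \<open>b\<close>.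
  Hence it suffices to delete the sets \<open>N(t) \<inter> B\<close> of size at most \<open>n\<^bsup>1/2\<^esup>\<close> and the vertices
  of \<open>A\<close> with more than \<open>n\<^bsup>1/2\<^esup>\<close> non-neighbours in \<open>B\<close>, which costs \<open>O(\<epsilon> n)\<close> vertices.
\<close>

section \<open>Paths and cycles as vertex lists\<close>

definition nbrs :: "'a set set \<Rightarrow> 'a \<Rightarrow> 'a set \<Rightarrow> 'a set" where
  "nbrs E v S = {u \<in> S. {v, u} \<in> E}"

definition is_path :: "'a set set \<Rightarrow> 'a list \<Rightarrow> bool" where
  "is_path E xs \<longleftrightarrow> distinct xs \<and> successively (\<lambda>u v. {u, v} \<in> E) xs"

lemma is_path_rev: "is_path E (rev xs) \<longleftrightarrow> is_path E xs"
  by (simp add: is_path_def successively_rev insert_commute)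

lemma is_path_singleton [simp]: "is_path E [x]"
  by (simp add: is_path_def)

lemma is_path_Cons:
  "is_path E (x # xs) \<longleftrightarrow> x \<notin> set xs \<and> is_path E xs \<and> (xs = [] \<or> {x, hd xs} \<in> E)"
  by (cases xs) (auto simp: is_path_def)

lemma is_path_append:
  "is_path E (xs @ ys) \<longleftrightarrow> set xs \<inter> set ys = {} \<and> is_path E xs \<and> is_path E ys \<and>
     (xs = [] \<or> ys = [] \<or> {last xs, hd ys} \<in> E)"
  by (auto simp: is_path_def successively_append_iff)

lemma is_path_nth:
  assumes "is_path E xs" "Suc i < length xs"
  shows "{xs ! i, xs ! Suc i} \<in> E"
  using assms by (simp add: is_path_def successively_conv_nth)

lemma contains_cycleI:
  assumes "is_path E xs" "set xs \<subseteq> V" "length xs = m" "{last xs, hd xs} \<in> E" "m \<ge> 3"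
  shows "contains_cycle m V E"
proof -
  let ?f = "\<lambda>i. xs ! i"
  have inj: "inj_on ?f {..<m}"
    using assms by (auto simp: is_path_def inj_on_def nth_eq_iff_index_eq)
  have cyc_sub: "e \<subseteq> {..<m}" if "e \<in> cycle_edges m" for e
    using that \<open>m \<ge> 3\<close> by (auto simp: cycle_edges_def)
  have edge: "{xs ! i, xs ! (Suc i mod m)} \<in> E" if "i < m" for i
  proof (cases "Suc i < m")
    case True
    then show ?thesis using is_path_nth[OF assms(1), of i] assms(3) by simp
  next
    case False
    then have "Suc i = m" using that by simp
    then have "Suc i mod m = 0" "i = length xs - 1" using assms(3) by auto
    moreover have "xs \<noteq> []" using assms by auto
    ultimately show ?thesis using assms(4) by (simp add: last_conv_nth hd_conv_nth)
  qed
  have ne: "Suc i mod m \<noteq> i" if "i < m" for i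
    using that \<open>m \<ge> 3\<close> by (cases "Suc i = m") auto
  \<comment> \<open>\<open>graph_isomorphic\<close> asks for an equivalence on edges, so
    \<open>F\<close> holds exactly the images of the cycle edges; chords lying in \<open>E\<close>
    must stay out.\<close>
  define F where "F = (\<lambda>e. ?f ` e) ` cycle_edges m"
  have FE: "F \<subseteq> E"
    using edge by (auto simp: F_def cycle_edges_def)
  have bij: "bij_betw ?f {..<m} (set xs)"
    using inj assms(3) by (auto simp: bij_betw_def set_conv_nth)
  have F2: "F \<subseteq> [set xs]\<^bsup>2\<^esup>"
  proof
    fix e assume "e \<in> F"
    then obtain i where i: "i < m" "e = {xs ! i, xs ! (Suc i mod m)}"
      by (auto simp: F_def cycle_edges_def)
    have j: "Suc i mod m < m" using \<open>m \<ge> 3\<close> by simp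
    have "xs ! i \<noteq> xs ! (Suc i mod m)"
      using inj_onD[OF inj, of i "Suc i mod m"] ne[OF i(1)] i(1) j by auto
    then show "e \<in> [set xs]\<^bsup>2\<^esup>"
      using i j assms(3) by (auto simp: nsets_def)
  qed
  have iff: "{u, v} \<in> cycle_edges m \<longleftrightarrow> {?f u, ?f v} \<in> F" if "u < m" "v < m" for u v
  proof
    assume "{?f u, ?f v} \<in> F"
    then obtain e where e: "e \<in> cycle_edges m" "?f ` {u, v} = ?f ` e"
      by (auto simp: F_def)
    have "{u, v} = e"
      using inj_on_image_eq_iff[OF inj, of "{u, v}" e] e cyc_sub[OF e(1)] that by auto
    then show "{u, v} \<in> cycle_edges m" using e by simp
  next
    assume "{u, v} \<in> cycle_edges m"
    then have "?f ` {u, v} \<in> F" unfolding F_def by (rule imageI)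
    then show "{?f u, ?f v} \<in> F" by simp
  qed
  have "subgraph_of (set xs) F V E"
    using FE F2 assms(2) by (simp add: subgraph_of_def)
  moreover have "graph_isomorphic {..<m} (cycle_edges m) (set xs) F"
    unfolding graph_isomorphic_def using bij iff by (intro exI[of _ ?f]) simp
  ultimately show ?thesis unfolding contains_cycle_def by blast
qed

text \<open>The new cycle must run through the added edge, for otherwise it would already exist in
  \<open>E\<close>. Removing that edge opens it into a path on the same \<open>m\<close>
  vertices.\<close>

lemma contains_cycle_insert_edgeE:
  assumes "contains_cycle m V (insert {a, b} E)" "\<not> contains_cycle m V E" "m \<ge> 3"
  obtains xs where "is_path E xs" "set xs \<subseteq> V" "length xs = m" "hd xs = a" "last xs = b"
proof -
  obtain W F f where W: "W \<subseteq> V" and F: "F \<subseteq> insert {a, b} E" and bij: "bij_betw f {..<m} W"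
    and iso: "\<forall>u\<in>{..<m}. \<forall>v\<in>{..<m}. {u, v} \<in> cycle_edges m \<longleftrightarrow> {f u, f v} \<in> F"
    using assms(1) unfolding contains_cycle_def subgraph_of_def graph_isomorphic_def by blast
  have inj: "inj_on f {..<m}" and im: "f ` {..<m} \<subseteq> V"
    using bij W by (auto simp: bij_betw_def)
  have modlt: "x mod m < m" for x using assms(3) by simp
  have edge: "{f i, f (Suc i mod m)} \<in> insert {a, b} E" if "i < m" for i
  proof -
    have "{i, Suc i mod m} \<in> cycle_edges m" using that by (auto simp: cycle_edges_def)
    then show ?thesis using iso F that modlt by blast
  qed
  have "\<exists>i<m. {f i, f (Suc i mod m)} = {a, b}"
  proof (rule ccontr)
    assume no: "\<not> ?thesis"
    then have e: "{f i, f (Suc i mod m)} \<in> E" if "i < m" for i using edge that by blast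
    let ?xs = "map f [0..<m]"
    have "is_path E ?xs"
    proof -
      have "{f i, f (Suc i)} \<in> E" if "Suc i < m" for i using e[of i] that by simp
      then show ?thesis using inj
        by (auto simp: is_path_def distinct_map successively_conv_nth atLeast0LessThan)
    qed
    moreover have "{last ?xs, hd ?xs} \<in> E"
      using e[of "m - 1"] assms(3) by (simp add: last_map hd_map)
    ultimately have "contains_cycle m V E"
      using contains_cycleI[of E ?xs V m] im assms(3) by (auto simp: atLeast0LessThan)
    then show False using assms(2) by simp
  qed
  then obtain i where i: "i < m" "{f i, f (Suc i mod m)} = {a, b}" by blast
  \<comment> \<open>The cycle is read starting right after the edge at \<open>i\<close>, so that
    this edge is the only one not between consecutive list entries.\<close>
  define q where "q j = f ((Suc i + j) mod m)" for j
  let ?xs = "map q [0..<m]"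
  have injm: "j = j'" if "(Suc i + j) mod m = (Suc i + j') mod m" "j < m" "j' < m" for j j'
    using that
  proof (induction j j' rule: linorder_wlog)
    case (le j j')
    then have "m dvd j' - j" using mod_eq_dvd_iff_nat[of "Suc i + j" "Suc i + j'" m] by simp
    then show ?case using le dvd_imp_le[of m "j' - j"] by (cases "j = j'") auto
  next
    case (sym j j')
    then show ?case by simp
  qed
  have "inj_on q {..<m}"
  proof (rule inj_onI)
    fix j j' assume "j \<in> {..<m}" "j' \<in> {..<m}" "q j = q j'"
    then show "j = j'"
      using injm[of j j'] inj_onD[OF inj, of "(Suc i + j) mod m" "(Suc i + j') mod m"] modlt
      by (simp add: q_def)
  qed
  moreover have "{q j, q (Suc j)} \<in> E" if "Suc j < m" for j
  proof -
    define r where "r = (Suc i + j) mod m"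
    have r: "r < m" using modlt r_def by simp
    have qs: "q (Suc j) = f (Suc r mod m)" by (simp add: q_def r_def mod_Suc_eq)
    have "{q j, q (Suc j)} \<noteq> {a, b}"
    proof
      assume "{q j, q (Suc j)} = {a, b}"
      then have "{f r, f (Suc r mod m)} = {f i, f (Suc i mod m)}"
        using i qs by (simp add: q_def r_def)
      then have "f r = f i \<or> f r = f (Suc i mod m) \<and> f (Suc r mod m) = f i"
        by (auto simp: doubleton_eq_iff)
      then have "r = i \<or> r = Suc i mod m \<and> Suc r mod m = i"
        using inj_onD[OF inj, of r i] inj_onD[OF inj, of r "Suc i mod m"]
          inj_onD[OF inj, of "Suc r mod m" i] modlt r i(1) by (simp del: One_nat_def) blast
      \<comment> \<open>The first case forces \<open>j = m - 1\<close>, against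
        \<open>Suc j < m\<close>. In the second the edge is met in reverse, so \<open>i + 2\<close>
        and \<open>i\<close> agree modulo \<open>m\<close>, which \<open>m \<ge> 3\<close>
        forbids.\<close>
      then show False
      proof
        assume "r = i"
        moreover have "(Suc i + (m - 1)) mod m = i" using i(1) by simp
        ultimately show False
          using injm[of j "m - 1"] that unfolding r_def by linarith
      next
        assume "r = Suc i mod m \<and> Suc r mod m = i"
        then have "Suc (Suc i) mod m = i mod m" using i(1) by (metis mod_Suc_eq mod_less)
        then have "m dvd 2" using mod_eq_dvd_iff_nat[of i "Suc (Suc i)" m] by simp
        then show False using assms(3) by (auto dest: dvd_imp_le)
      qed
    qed
    then show ?thesis using edge[OF r] qs by (auto simp: q_def r_def)
  qed
  ultimately have path: "is_path E ?xs"
    by (auto simp: is_path_def distinct_map successively_conv_nth atLeast0LessThan)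
  have sub: "set ?xs \<subseteq> V" using im modlt by (auto simp: q_def)
  have hd: "hd ?xs = f (Suc i mod m)" using assms(3) by (simp add: hd_map q_def)
  have last: "last ?xs = f i" using assms(3) i(1) by (simp add: last_map q_def)
  from i(2) consider "f i = b" "f (Suc i mod m) = a" | "f i = a" "f (Suc i mod m) = b"
    by (auto simp: doubleton_eq_iff)
  then show thesis
  proof cases
    case 1
    then show thesis using that[of ?xs] path sub hd last by simp
  next
    case 2
    have "?xs \<noteq> []" using assms(3) by simp
    then have "hd (rev ?xs) = a" "last (rev ?xs) = b"
      unfolding hd_rev last_rev hd last using 2 by simp_all
    then show thesis using that[of "rev ?xs"] path sub by (simp add: is_path_rev del: rev_map)
  qed
qed

section \<open>Well-linked pairs of vertex sets\<close>

lemma nbrs_subset: "nbrs E v S \<subseteq> S"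
  by (auto simp: nbrs_def)

lemma finite_nbrs: "finite S \<Longrightarrow> finite (nbrs E v S)"
  by (auto simp: nbrs_def)

text \<open>Common neighbourhoods rather than degrees are bounded below: a greedily built path can
  then also hit a prescribed endpoint while avoiding fewer than \<open>K\<close> forbidden vertices.
  Edges inside \<open>X\<close> or \<open>Y\<close> are allowed, as the notion is also applied
  before independence is known.\<close>

definition well_linked :: "'a set set \<Rightarrow> nat \<Rightarrow> 'a set \<Rightarrow> 'a set \<Rightarrow> bool" where
  "well_linked E K X Y \<longleftrightarrow> X \<inter> Y = {} \<and>
     (\<forall>u\<in>X. \<forall>w\<in>X. K \<le> card (nbrs E u Y \<inter> nbrs E w Y)) \<and>
     (\<forall>u\<in>Y. \<forall>w\<in>Y. K \<le> card (nbrs E u X \<inter> nbrs E w X))"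

lemma well_linked_sym: "well_linked E K X Y \<Longrightarrow> well_linked E K Y X"
  by (auto simp: well_linked_def)

lemma well_linked_common:
  assumes "well_linked E K X Y" "u \<in> X" "w \<in> X" "finite F" "card F < K"
  obtains y where "y \<in> Y" "y \<notin> F" "{u, y} \<in> E" "{w, y} \<in> E"
proof -
  have "K \<le> card (nbrs E u Y \<inter> nbrs E w Y)"
    using assms by (auto simp: well_linked_def)
  then have "\<not> nbrs E u Y \<inter> nbrs E w Y \<subseteq> F"
    using card_mono[OF assms(4), of "nbrs E u Y \<inter> nbrs E w Y"] assms(5) by linarith
  then show thesis using that by (auto simp: nbrs_def)
qed

text \<open>Each round moves from \<open>u\<close> through a fresh \<open>y\<close> to a fresh
  \<open>u'\<close> in \<open>X\<close> and forbids \<open>u\<close> and \<open>y\<close> from then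
  on; the two extra forbidden vertices are paid for by the drop in \<open>j\<close>. The last round
  uses a common neighbour with \<open>w\<close>.\<close>

lemma well_linked_even_path:
  assumes "well_linked E K X Y" "u \<in> X" "w \<in> X" "u \<noteq> w" "finite F" "u \<notin> F" "w \<notin> F"
    and "card F + 2 * Suc j < K"
  shows "\<exists>xs. is_path E xs \<and> set xs \<subseteq> X \<union> Y \<and> set xs \<inter> F = {} \<and> length xs = 2 * Suc j + 1 \<and>
           hd xs = u \<and> last xs = w"
  using assms(2,4-8)
proof (induction j arbitrary: u F)
  case 0
  have disj: "X \<inter> Y = {}" using assms(1) by (simp add: well_linked_def)
  obtain y where "y \<in> Y" "y \<notin> F" "{u, y} \<in> E" "{w, y} \<in> E"
    using well_linked_common[OF assms(1) 0(1) assms(3) 0(3)] 0 by auto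
  then show ?case
    using 0 assms(3) disj
    by (intro exI[of _ "[u, y, w]"]) (auto simp: is_path_def insert_commute)
next
  case (Suc j)
  have disj: "X \<inter> Y = {}" using assms(1) by (simp add: well_linked_def)
  \<comment> \<open>The common neighbours of a vertex with itself are its neighbours, so linkedness
    acts as a degree bound here.\<close>
  obtain y where y: "y \<in> Y" "y \<notin> F" "{u, y} \<in> E"
    using well_linked_common[OF assms(1) Suc.prems(1,1,3)] Suc.prems by auto
  have "card (F \<union> {u, w}) \<le> card F + card {u, w}" by (rule card_Un_le)
  then have c: "card (F \<union> {u, w}) < K" using Suc.prems by auto
  obtain u' where u': "u' \<in> X" "u' \<notin> F \<union> {u, w}" "{y, u'} \<in> E"
    using well_linked_common[OF well_linked_sym[OF assms(1)] y(1,1) _ c] Suc.prems(3) by auto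
  have c': "card (F \<union> {u, y}) \<le> card F + 2"
    using card_Un_le[of F "{u, y}"] by (metis card_2_iff disj IntI y(1) Suc.prems(1) emptyE)
  obtain xs where xs: "is_path E xs" "set xs \<subseteq> X \<union> Y" "set xs \<inter> (F \<union> {u, y}) = {}"
    "length xs = 2 * Suc j + 1" "hd xs = u'" "last xs = w"
    using Suc.IH[of u' "F \<union> {u, y}"] Suc.prems u' y assms(3) c' disj by auto
  then have "xs \<noteq> []" by auto
  then show ?case
    using xs u' y Suc.prems disj
    by (intro exI[of _ "u # y # xs"]) (auto simp: is_path_Cons)
qed

text \<open>Here \<open>l\<close> counts vertices, so an odd \<open>l\<close> ends on the side of
  \<open>u\<close>. For even \<open>l\<close> the path is sent to a neighbour \<open>x\<close> of
  \<open>w\<close> in \<open>X\<close>, and \<open>w\<close> is appended.\<close>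

lemma well_linked_path_aux:
  assumes "well_linked E K X Y" "u \<in> X" "w \<in> X \<union> Y" "u \<noteq> w" "finite F" "u \<notin> F" "w \<notin> F"
    and "card F + l < K" "l \<ge> 3" "w \<in> X \<longleftrightarrow> odd l"
  shows "\<exists>xs. is_path E xs \<and> set xs \<subseteq> X \<union> Y \<and> set xs \<inter> F = {} \<and> length xs = l \<and>
           hd xs = u \<and> last xs = w"
proof (cases "w \<in> X")
  case True
  then obtain i where "l = 2 * i + 1" using assms by (auto elim: oddE)
  moreover from this obtain j where "i = Suc j" using assms(9) by (cases i) auto
  ultimately show ?thesis
    using well_linked_even_path[OF assms(1,2) True assms(4-7), of j] assms(8) by auto
next
  case False
  then have w: "w \<in> Y" using assms by auto
  obtain i where i: "l = 2 * i" using assms False by (auto elim: evenE)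
  obtain j where j: "i = Suc (Suc j)" using assms(9) i by (cases i; cases "i - 1") auto
  have disj: "X \<inter> Y = {}" using assms(1) by (simp add: well_linked_def)
  have c: "card (insert u F) < K" "card (insert w F) + 2 * Suc j < K"
    using assms(5,8) i j by (auto simp: card_insert_if)
  obtain x where x: "x \<in> X" "x \<notin> insert u F" "{w, x} \<in> E"
    using well_linked_common[OF well_linked_sym[OF assms(1)] w w _ c(1)] assms(5) by auto
  obtain xs where xs: "is_path E xs" "set xs \<subseteq> X \<union> Y" "set xs \<inter> insert w F = {}"
    "length xs = 2 * Suc j + 1" "hd xs = u" "last xs = x"
    using well_linked_even_path[OF assms(1,2) x(1), of "insert w F" j] x assms c disj w by auto
  then have "xs \<noteq> []" by auto
  then show ?thesis
    using xs x w i j assms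
    by (intro exI[of _ "xs @ [w]"]) (auto simp: is_path_append insert_commute)
qed

lemma well_linked_path:
  assumes "well_linked E K X Y" "u \<in> X \<union> Y" "w \<in> X \<union> Y" "u \<noteq> w" "finite F" "u \<notin> F" "w \<notin> F"
    and "card F + l < K" "l \<ge> 3" "(u \<in> X \<longleftrightarrow> w \<in> X) \<longleftrightarrow> odd l"
  shows "\<exists>xs. is_path E xs \<and> set xs \<subseteq> X \<union> Y \<and> set xs \<inter> F = {} \<and> length xs = l \<and>
           hd xs = u \<and> last xs = w"
proof (cases "u \<in> X")
  case True
  then show ?thesis using well_linked_path_aux[OF assms(1) True assms(3-9)] assms(10) by simp
next
  case False
  then have u: "u \<in> Y" using assms by auto
  have "w \<in> Y \<longleftrightarrow> w \<notin> X" using assms(1,3) by (auto simp: well_linked_def)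
  then show ?thesis
    using well_linked_path_aux[OF well_linked_sym[OF assms(1)] u _ assms(4-9)] assms(3,10) False
    by (simp add: Un_commute)
qed

text \<open>An excursion \<open>xs\<close> of the wrong parity could be closed up inside the linked
  pair by a path with exactly \<open>2 * k + 1 - length xs\<close> vertices, giving the forbidden
  cycle. The value \<open>2 * k + 2\<close> leaves enough room for that path to avoid
  \<open>xs\<close>.\<close>

lemma no_odd_detour:
  assumes free: "\<not> contains_cycle (2 * k + 1) V E" and "k \<ge> 2"
    and linked: "well_linked E (2 * k + 2) X Y" "X \<union> Y \<subseteq> V"
    and xs: "is_path E xs" "set xs \<subseteq> V" "xs \<noteq> []" "length xs + 2 \<le> 2 * k"
    and ends: "u \<in> X \<union> Y" "w \<in> X \<union> Y" "u \<noteq> w" "u \<notin> set xs" "w \<notin> set xs"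
      "{u, hd xs} \<in> E" "{last xs, w} \<in> E"
  shows "(u \<in> X \<longleftrightarrow> w \<in> X) \<longleftrightarrow> odd (length xs)"
proof (rule ccontr)
  assume parity: "\<not> ?thesis"
  \<comment> \<open>The bound on \<open>length xs\<close> gives \<open>l \<ge> 3\<close>, the
    shortest length that \<open>well_linked_path\<close> supplies.\<close>
  define l where "l = 2 * k + 1 - length xs"
  have l: "l \<ge> 3" "length xs + l = 2 * k + 1" using xs(4) by (auto simp: l_def)
  have "even (length xs + l) \<longleftrightarrow> False" unfolding l by simp
  then have par: "(w \<in> X \<longleftrightarrow> u \<in> X) \<longleftrightarrow> odd l" using parity by auto
  have "card (set xs) + l < 2 * k + 2" using card_length[of xs] l by linarith
  then obtain ys where ys: "is_path E ys" "set ys \<subseteq> X \<union> Y" "set ys \<inter> set xs = {}" "length ys = l"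
    "hd ys = w" "last ys = u"
    using well_linked_path[OF linked(1) ends(2,1) _ _ ends(5,4) _ l(1) par] ends(3) by auto
  have "ys \<noteq> []" using ys(4) l by auto
  then have "is_path E (xs @ ys)" "{last (xs @ ys), hd (xs @ ys)} \<in> E"
    using xs ys ends by (auto simp: is_path_append)
  then have "contains_cycle (2 * k + 1) V E"
    using xs ys linked(2) l assms(2) by (intro contains_cycleI[of E "xs @ ys"]) auto
  then show False using free by simp
qed

section \<open>Degree sums in graphs without a path on \<open>L\<close> vertices\<close>

lemma path_of_min_degree:
  assumes "finite U" "U \<noteq> {}" "\<And>v. v \<in> U \<Longrightarrow> L \<le> card (nbrs E v U)" "0 < l" "l \<le> L"
  shows "\<exists>xs. is_path E xs \<and> set xs \<subseteq> U \<and> length xs = l"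
  using assms(4,5)
proof (induction l)
  case (Suc l)
  show ?case
  proof (cases "l = 0")
    case True
    obtain v where "v \<in> U" using assms(2) by blast
    then show ?thesis using True by (intro exI[of _ "[v]"]) (auto simp: is_path_def)
  next
    case False
    then obtain xs where xs: "is_path E xs" "set xs \<subseteq> U" "length xs = l"
      using Suc by auto
    then have ne: "xs \<noteq> []" using False by auto
    then have "L \<le> card (nbrs E (hd xs) U)" using assms(3) xs(2) hd_in_set by blast
    then have "\<not> nbrs E (hd xs) U \<subseteq> set xs"
      using card_mono[of "set xs" "nbrs E (hd xs) U"] card_length[of xs] xs(3) Suc.prems by fastforce
    then obtain v where "v \<in> U" "v \<notin> set xs" "{v, hd xs} \<in> E"
      by (auto simp: nbrs_def insert_commute)
    then show ?thesis using xs ne by (intro exI[of _ "v # xs"]) (auto simp: is_path_Cons)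
  qed
qed simp

text \<open>A weak Erdos-Gallai bound: by \<open>path_of_min_degree\<close> some vertex has fewer
  than \<open>L\<close> neighbours, and deleting it lowers the degree sum by at most
  \<open>2 * L\<close>, since each lost edge counts at both ends.\<close>

lemma degree_sum_of_path_free:
  assumes "finite U" "L > 0"
    and "\<not> (\<exists>xs. is_path E xs \<and> set xs \<subseteq> U \<and> length xs = L)"
  shows "(\<Sum>v\<in>U. card (nbrs E v U)) \<le> 2 * L * card U"
  using assms
proof (induction "card U" arbitrary: U)
  case 0
  then show ?case by simp
next
  case (Suc n)
  then have "U \<noteq> {}" by auto
  then obtain v where v: "v \<in> U" "card (nbrs E v U) < L"
    using path_of_min_degree[of U L E L] Suc.prems by (meson le_refl not_less)
  define U' where "U' = U - {v}"
  have U: "U = insert v U'" "v \<notin> U'" "finite U'" using v Suc.prems by (auto simp: U'_def)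
  have IH: "(\<Sum>u\<in>U'. card (nbrs E u U')) \<le> 2 * L * card U'"
    using Suc U by (intro Suc.hyps) auto
  have step: "card (nbrs E u U) \<le> card (nbrs E u U') + (if {v, u} \<in> E then 1 else 0)" for u
  proof -
    have "nbrs E u U \<subseteq> nbrs E u U' \<union> (if {v, u} \<in> E then {v} else {})"
      by (auto simp: nbrs_def U insert_commute)
    then have "card (nbrs E u U) \<le> card (nbrs E u U' \<union> (if {v, u} \<in> E then {v} else {}))"
      using U by (intro card_mono) (auto simp: finite_nbrs)
    also have "\<dots> \<le> card (nbrs E u U') + card (if {v, u} \<in> E then {v} else {})"
      by (rule card_Un_le)
    finally show ?thesis by (simp split: if_splits)
  qed
  have "(\<Sum>u\<in>U'. if {v, u} \<in> E then 1 else 0) = card (nbrs E v U')"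
    using U by (simp add: sum.If_cases nbrs_def Int_def)
  also have "\<dots> \<le> card (nbrs E v U)"
    using Suc.prems(1) U by (intro card_mono) (auto simp: nbrs_def)
  finally have "(\<Sum>u\<in>U'. if {v, u} \<in> E then 1 else 0) \<le> L" using v by simp
  moreover have "(\<Sum>u\<in>U'. card (nbrs E u U)) \<le>
      (\<Sum>u\<in>U'. card (nbrs E u U')) + (\<Sum>u\<in>U'. if {v, u} \<in> E then 1 else 0)"
    unfolding sum.distrib[symmetric] by (rule sum_mono) (rule step)
  moreover have "(\<Sum>u\<in>U. card (nbrs E u U)) = card (nbrs E v U) + (\<Sum>u\<in>U'. card (nbrs E u U))"
    by (subst U(1)) (use U in \<open>simp\<close>)
  ultimately have "(\<Sum>u\<in>U. card (nbrs E u U)) \<le> L + (2 * L * card U' + L)"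
    using IH v by linarith
  also have "\<dots> = 2 * L * card U" using U by (simp add: algebra_simps)
  finally show ?case .
qed

section \<open>Dense graphs without a short odd cycle are bipartite\<close>

text \<open>Joining \<open>x\<close> to both ends of a path inside its neighbourhood gives a cycle
  with one more vertex. With \<open>l = 2 * k\<close> this makes neighbourhoods sparse.\<close>

lemma nbrs_path_free:
  assumes "\<not> contains_cycle (Suc l) V E" "l \<ge> 2" "\<And>v. {v} \<notin> E" "S \<subseteq> V" "x \<in> V"
  shows "\<not> (\<exists>xs. is_path E xs \<and> set xs \<subseteq> nbrs E x S \<and> length xs = l)"
proof
  assume "\<exists>xs. is_path E xs \<and> set xs \<subseteq> nbrs E x S \<and> length xs = l"
  then obtain xs where xs: "is_path E xs" "set xs \<subseteq> nbrs E x S" "length xs = l" by blast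
  then have ne: "xs \<noteq> []" using assms(2) by auto
  have adj: "{x, v} \<in> E" "v \<in> V" if "v \<in> set xs" for v
    using that xs(2) assms(4) by (auto simp: nbrs_def)
  have "x \<notin> set xs" using adj(1)[of x] assms(3)[of x] by auto
  then have "is_path E (x # xs)" "{last (x # xs), hd (x # xs)} \<in> E"
    using xs ne adj(1)[of "hd xs"] adj(1)[of "last xs"] by (auto simp: is_path_Cons insert_commute)
  then have "contains_cycle (Suc l) V E"
    using xs(3) adj(2) assms(2,5) by (intro contains_cycleI[of E "x # xs"]) auto
  then show False using assms(1) by simp
qed

text \<open>Markov's inequality for the degrees inside \<open>U\<close> at the threshold
  \<open>m / 50\<close>.\<close>

lemma card_high_degree_le:
  assumes "finite U" "m > 0" "(\<Sum>v\<in>U. card (nbrs E v U)) \<le> 4 * k * card U" "card U \<le> m"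
  shows "card {v \<in> U. m \<le> 50 * card (nbrs E v U)} \<le> 200 * k"
proof -
  let ?Z = "{v \<in> U. m \<le> 50 * card (nbrs E v U)}"
  have "card ?Z * m = (\<Sum>v\<in>?Z. m)" by simp
  also have "\<dots> \<le> (\<Sum>v\<in>?Z. 50 * card (nbrs E v U))" by (rule sum_mono) simp
  also have "\<dots> \<le> (\<Sum>v\<in>U. 50 * card (nbrs E v U))" using assms(1) by (intro sum_mono2) auto
  also have "\<dots> \<le> 200 * k * card U" using assms(3) by (simp flip: sum_distrib_left)
  also have "\<dots> \<le> 200 * k * m" using assms(4) by (intro mult_left_mono) auto
  finally show ?thesis using assms(2) by simp
qed

text \<open>Meant for \<open>P\<close> and \<open>Q\<close> the neighbourhoods of two adjacent
  vertices. Trimming leaves vertices of \<open>P\<close> with few neighbours in \<open>P\<close>,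
  which therefore send almost all their edges to \<open>Q\<close>.\<close>

definition low_part :: "'a set set \<Rightarrow> 'a set \<Rightarrow> 'a set \<Rightarrow> 'a set \<Rightarrow> 'a set" where
  "low_part E S P Q = {v \<in> P - Q. 50 * card (nbrs E v P) < card S}"

text \<open>In units of \<open>card S\<close>, and up to multiples of \<open>k\<close>, both
  vertices have at least 0.42 of their neighbours in the trimmed \<open>P\<close>, a set of size at
  most 0.52. Hence they share about 0.32.\<close>

lemma low_part_common_nbrs:
  assumes "finite S" "P \<subseteq> S" "Q \<subseteq> S"
    and deg: "\<And>v. v \<in> S \<Longrightarrow> 12 * card S \<le> 25 * card (nbrs E v S)"
    and cards: "12 * card S \<le> 25 * card P" "12 * card S \<le> 25 * card Q" "card (P \<inter> Q) \<le> 4 * k"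
    and bad: "card {v \<in> P. card S \<le> 50 * card (nbrs E v P)} \<le> 200 * k"
    and large: "card S \<ge> 100000 * k" "k \<ge> 2"
    and uw: "u \<in> low_part E S Q P" "w \<in> low_part E S Q P"
  shows "2 * k + 2 \<le> card (nbrs E u (low_part E S P Q) \<inter> nbrs E w (low_part E S P Q))"
proof -
  let ?P = "low_part E S P Q" and ?bad = "{v \<in> P. card S \<le> 50 * card (nbrs E v P)}"
  have "finite P" "finite Q" using assms(1-3) by (auto intro: finite_subset)
  then have fin: "finite P" "finite Q" "finite ?P" "finite ?bad" "?P \<subseteq> P"
    by (auto simp: low_part_def)
  have PQ: "card P + card Q = card (P \<union> Q) + card (P \<inter> Q)"
    using fin by (intro card_Un_Int) auto
  have rest: "card (S - (P \<union> Q)) + card (P \<union> Q) = card S"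
    using assms(1-3) fin by (subst card_Diff_subset) (auto intro!: le_add_diff_inverse2 card_mono)
  \<comment> \<open>Of the degree 0.48, at most 0.02 goes to \<open>Q\<close> and 0.04 outside
    \<open>P \<union> Q\<close>, leaving 0.42. The error \<open>204 * k\<close> consists of
    \<open>4 * k\<close> for the overlap and \<open>200 * k\<close> for the bad vertices.\<close>
  have *: "100 * card (nbrs E v ?P) + 20400 * k \<ge> 42 * card S" if v: "v \<in> low_part E S Q P" for v
  proof -
    have vS: "v \<in> S" and low: "50 * card (nbrs E v Q) < card S"
      using v assms(3) by (auto simp: low_part_def)
    have "nbrs E v S \<subseteq> nbrs E v ?P \<union> nbrs E v Q \<union> (S - (P \<union> Q)) \<union> ?bad"
      by (auto simp: nbrs_def low_part_def)
    then have "card (nbrs E v S) \<le> card (nbrs E v ?P \<union> nbrs E v Q \<union> (S - (P \<union> Q)) \<union> ?bad)"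
      using fin assms(1) by (intro card_mono) (auto simp: finite_nbrs)
    also have "\<dots> \<le> card (nbrs E v ?P) + card (nbrs E v Q) + card (S - (P \<union> Q)) + card ?bad"
      by (meson add_le_mono1 card_Un_le le_trans)
    finally show ?thesis using low deg[OF vS] rest PQ cards bad by linarith
  qed
  have P: "card ?P + card Q \<le> card S"
  proof -
    have "card ?P + card Q = card (?P \<union> Q)"
      using fin by (intro card_Un_disjoint[symmetric]) (auto simp: low_part_def)
    also have "\<dots> \<le> card S" using assms(1-3) fin by (intro card_mono) auto
    finally show ?thesis .
  qed
  have "card (nbrs E u ?P) + card (nbrs E w ?P) =
      card (nbrs E u ?P \<union> nbrs E w ?P) + card (nbrs E u ?P \<inter> nbrs E w ?P)"
    using fin by (intro card_Un_Int) (auto simp: finite_nbrs)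
  moreover have "card (nbrs E u ?P \<union> nbrs E w ?P) \<le> card ?P"
    using fin by (intro card_mono) (auto simp: nbrs_def)
  ultimately show ?thesis using *[OF uw(1)] *[OF uw(2)] P cards large by linarith
qed

text \<open>The trimmed neighbourhoods \<open>X0\<close>, \<open>Y0\<close> of two adjacent vertices
  with few common neighbours are well linked. By \<open>no_odd_detour\<close> no vertex of
  \<open>S\<close> sees both of them, and two vertices seeing the same one are not adjacent. So the
  vertices of \<open>S\<close> are classified by the set they see.\<close>

lemma bipartite_of_min_degree:
  assumes free: "\<not> contains_cycle (2 * k + 1) V E" and "k \<ge> 2"
    and loopless: "\<And>v. {v} \<notin> E" and S: "finite S" "S \<subseteq> V"
    and large: "card S \<ge> 100000 * k"
    and deg: "\<And>v. v \<in> S \<Longrightarrow> 12 * card S \<le> 25 * card (nbrs E v S)"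
  obtains A B where "A \<union> B = S" "A \<inter> B = {}"
    "\<And>a a'. a \<in> A \<Longrightarrow> a' \<in> A \<Longrightarrow> {a, a'} \<notin> E"
    "\<And>b b'. b \<in> B \<Longrightarrow> b' \<in> B \<Longrightarrow> {b, b'} \<notin> E"
proof -
  define m where "m = card S"
  have m: "m > 0" using large assms(2) by (simp add: m_def)
  have fin: "finite (nbrs E v S)" for v using S(1) by (rule finite_nbrs)
  have dsum: "(\<Sum>v\<in>nbrs E x S. card (nbrs E v (nbrs E x S))) \<le> 4 * k * card (nbrs E x S)"
    if "x \<in> S" for x
    using degree_sum_of_path_free[OF fin, of "2 * k" E x]
      nbrs_path_free[of "2 * k" V E S x] free loopless S that assms(2) by (simp add: subset_iff)
  have bad: "card {v \<in> nbrs E x S. m \<le> 50 * card (nbrs E v (nbrs E x S))} \<le> 200 * k"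
    if "x \<in> S" for x
    using card_high_degree_le[OF fin m dsum[OF that]] card_mono[OF S(1) nbrs_subset] m_def by simp
  obtain x where x: "x \<in> S" using m by (fastforce simp: m_def)
  define Y where "Y = nbrs E x S"
  have finY: "finite Y" by (simp add: Y_def fin)
  have Yne: "card Y > 0" using deg[OF x] m unfolding Y_def m_def by linarith
  \<comment> \<open>Averaging: the degree sum inside \<open>Y\<close> is at most
    \<open>4 * k * card Y\<close>.\<close>
  have "\<exists>y\<in>Y. card (nbrs E y Y) \<le> 4 * k"
  proof (rule ccontr)
    assume "\<not> ?thesis"
    then have "(\<Sum>v\<in>Y. 4 * k + 1) \<le> (\<Sum>v\<in>Y. card (nbrs E v Y))"
      by (intro sum_mono) (auto simp: not_le)
    then show False using dsum[OF x] Yne unfolding Y_def by (simp add: mult.commute)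
  qed
  then obtain y where y: "y \<in> Y" "card (nbrs E y Y) \<le> 4 * k" by blast
  have yS: "y \<in> S" using y by (simp add: Y_def nbrs_def)
  define X where "X = nbrs E y S"
  have XY: "X \<subseteq> S" "Y \<subseteq> S" "X \<inter> Y = nbrs E y Y" by (auto simp: X_def Y_def nbrs_def)
  have finX: "finite X" by (simp add: X_def fin)
  have cards: "12 * card S \<le> 25 * card X" "12 * card S \<le> 25 * card Y" "card (X \<inter> Y) \<le> 4 * k"
    "card (Y \<inter> X) \<le> 4 * k"
    using deg[OF x] deg[OF yS] y XY(3) by (simp_all add: X_def Y_def Int_commute)
  define X0 where "X0 = low_part E S X Y"
  define Y0 where "Y0 = low_part E S Y X"
  have badX: "card {v \<in> X. card S \<le> 50 * card (nbrs E v X)} \<le> 200 * k"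
    and badY: "card {v \<in> Y. card S \<le> 50 * card (nbrs E v Y)} \<le> 200 * k"
    using bad[OF x] bad[OF yS] by (simp_all add: X_def Y_def m_def)
  have linked: "well_linked E (2 * k + 2) X0 Y0"
    using low_part_common_nbrs[OF S(1) XY(1,2) deg cards(1,2,3) badX large assms(2)]
      low_part_common_nbrs[OF S(1) XY(2,1) deg cards(2,1,4) badY large assms(2)]
    by (auto simp: well_linked_def X0_def Y0_def low_part_def)
  have sub: "X0 \<union> Y0 \<subseteq> S" using XY by (auto simp: X0_def Y0_def low_part_def)
  have fin0: "finite X0" "finite Y0" using sub S(1) by (auto intro: finite_subset)
  have rest: "card (S - (X \<union> Y)) + card (X \<union> Y) = card S"
    using S XY finX finY by (subst card_Diff_subset) (auto intro!: le_add_diff_inverse2 card_mono)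
  have PQ: "card X + card Y = card (X \<union> Y) + card (X \<inter> Y)"
    using finX finY by (intro card_Un_Int) auto
  \<comment> \<open>Outside \<open>X0 \<union> Y0\<close> there are at most about 0.04 of the
    vertices of \<open>S\<close>, far fewer than the degree 0.48. Four neighbours leave room for the
    choices in \<open>no_edge\<close>, which exclude at most two vertices.\<close>
  have many: "card (nbrs E v X0) + card (nbrs E v Y0) \<ge> 4" if "v \<in> S" for v
  proof -
    let ?bX = "{v \<in> X. card S \<le> 50 * card (nbrs E v X)}"
    let ?bY = "{v \<in> Y. card S \<le> 50 * card (nbrs E v Y)}"
    have "nbrs E v S \<subseteq> nbrs E v X0 \<union> nbrs E v Y0 \<union> (S - (X \<union> Y)) \<union> (X \<inter> Y) \<union> ?bX \<union> ?bY"
      by (auto simp: nbrs_def X0_def Y0_def low_part_def)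
    then have "card (nbrs E v S) \<le>
        card (nbrs E v X0 \<union> nbrs E v Y0 \<union> (S - (X \<union> Y)) \<union> (X \<inter> Y) \<union> ?bX \<union> ?bY)"
      using fin0 finX finY S(1) by (intro card_mono) (auto simp: finite_nbrs)
    also have "\<dots> \<le> card (nbrs E v X0) + card (nbrs E v Y0) + card (S - (X \<union> Y)) + card (X \<inter> Y)
        + card ?bX + card ?bY"
      by (meson add_le_mono1 card_Un_le le_trans)
    finally show ?thesis using deg[OF that] rest PQ cards badX badY large assms(2) by linarith
  qed
  \<comment> \<open>A vertex with neighbours in both sets would be a one-vertex excursion that
    changes sides.\<close>
  have one_side: "nbrs E v X0 = {} \<or> nbrs E v Y0 = {}" if "v \<in> S" for v
  proof (rule ccontr)
    assume "\<not> ?thesis"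
    then obtain p q where pq: "p \<in> X0" "q \<in> Y0" "{v, p} \<in> E" "{v, q} \<in> E"
      by (auto simp: nbrs_def)
    have "p \<noteq> v" "q \<noteq> v" using pq loopless[of v] by auto
    moreover have "p \<noteq> q" "q \<notin> X0" using pq linked by (auto simp: well_linked_def)
    ultimately show False
      using no_odd_detour[OF free assms(2) linked _ , of "[v]" p q] pq sub S that assms(2)
      by (auto simp: insert_commute)
  qed
  \<comment> \<open>The edge \<open>{a, a'}\<close> would be a two-vertex excursion returning to the
    same side. Such an excursion is short enough for \<open>no_odd_detour\<close> because
    \<open>k \<ge> 2\<close>.\<close>
  have no_edge: False
    if "a \<in> S" "a' \<in> S" "{a, a'} \<in> E" "card (nbrs E a P) \<ge> 4" "card (nbrs E a' P) \<ge> 4"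
      "P = X0 \<or> P = Y0" for a a' P
  proof -
    have "\<not> nbrs E a P \<subseteq> {a'}" using that(4) card_mono[of "{a'}" "nbrs E a P"] by auto
    then obtain p where p: "p \<in> P" "{p, a} \<in> E" "p \<noteq> a'" by (auto simp: nbrs_def insert_commute)
    have "\<not> nbrs E a' P \<subseteq> {a, p}"
      using that(5) card_mono[of "{a, p}" "nbrs E a' P"] card_insert_le_m1[of 2 "{p}" a] by auto
    then obtain q where q: "q \<in> P" "{a', q} \<in> E" "q \<noteq> a" "q \<noteq> p" by (auto simp: nbrs_def)
    have "p \<noteq> a" "q \<noteq> a'" "a \<noteq> a'" using p q that loopless by auto
    moreover have "p \<in> X0 \<longleftrightarrow> q \<in> X0" using that(6) p q linked by (auto simp: well_linked_def)
    ultimately show False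
      using no_odd_detour[OF free assms(2) linked _ , of "[a, a']" p q] p q that sub S assms(2)
      by (auto simp: is_path_def)
  qed
  define A where "A = {v \<in> S. nbrs E v X0 = {}}"
  show thesis
  proof (rule that[of A "S - A"])
    fix a a' assume "a \<in> A" "a' \<in> A"
    then show "{a, a'} \<notin> E"
      using no_edge[of a a' Y0] many[of a] many[of a'] by (auto simp: A_def)
  next
    fix b b' assume "b \<in> S - A" "b' \<in> S - A"
    then show "{b, b'} \<notin> E"
      using no_edge[of b b' X0] many[of b] many[of b'] one_side[of b] one_side[of b']
      by (auto simp: A_def)
  qed (auto simp: A_def)
qed

section \<open>Non-adjacent pairs across the bipartition\<close>

lemma is_path_sublist:
  assumes "is_path E xs"
  shows "is_path E (take l (drop i xs))"
proof -
  have "is_path E (take i xs @ take l (drop i xs) @ drop l (drop i xs))"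
    using assms by (simp only: append_take_drop_id)
  then show ?thesis by (simp only: is_path_append)
qed

text \<open>A path of even length from \<open>A\<close> to \<open>B\<close> must break the
  alternation somewhere. Between the first wrong position \<open>j\<close> and the last core
  position \<open>i\<close> before it the path stays outside the core, and
  \<open>no_odd_detour\<close> rules this out unless the excursion is the whole interior.\<close>

lemma odd_path_avoids_core:
  assumes free: "\<not> contains_cycle (2 * k + 1) V E" and "k \<ge> 2"
    and linked: "well_linked E (2 * k + 2) A B" "A \<union> B \<subseteq> V"
    and indA: "\<And>a a'. a \<in> A \<Longrightarrow> a' \<in> A \<Longrightarrow> {a, a'} \<notin> E"
    and indB: "\<And>b b'. b \<in> B \<Longrightarrow> b' \<in> B \<Longrightarrow> {b, b'} \<notin> E"
    and xs: "is_path E xs" "set xs \<subseteq> V" "length xs = 2 * k + 1" "hd xs \<in> A" "last xs \<in> B"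
    and l: "0 < l" "l < 2 * k"
  shows "xs ! l \<notin> A \<union> B"
proof -
  have disj: "A \<inter> B = {}" using linked by (simp add: well_linked_def)
  have ne: "xs \<noteq> []" using xs(3) by auto
  have ends: "xs ! 0 \<in> A" "xs ! (2 * k) \<in> B"
    using xs(3-5) ne by (auto simp: hd_conv_nth last_conv_nth)
  have dist: "xs ! p = xs ! q \<longleftrightarrow> p = q" if "p \<le> 2 * k" "q \<le> 2 * k" for p q
    using that xs(1,3) by (simp add: is_path_def nth_eq_iff_index_eq)
  \<comment> \<open>Position \<open>p\<close> is wrong if the vertex is not on the side predicted by alternation from \<open>hd xs\<close>.\<close>
  define wrong where "wrong p \<longleftrightarrow> xs ! p \<in> A \<union> B \<and> (xs ! p \<in> A \<longleftrightarrow> odd p)" for p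
  have "wrong (2 * k)" using ends disj by (auto simp: wrong_def)
  define j where "j = (LEAST p. wrong p)"
  have j: "wrong j" "j \<le> 2 * k"
    unfolding j_def using \<open>wrong (2 * k)\<close> by (auto intro: LeastI Least_le)
  have least: "\<not> wrong p" if "p < j" for p using that not_less_Least unfolding j_def by blast
  have "\<not> wrong 0" using ends by (simp add: wrong_def)
  then have "j > 0" using j(1) by (cases j) auto
  define I where "I = {p. p < j \<and> xs ! p \<in> A \<union> B}"
  have I: "finite I" "0 \<in> I" using \<open>j > 0\<close> ends by (auto simp: I_def)
  define i where "i = Max I"
  have "i \<in> I" unfolding i_def using I by (intro Max_in) auto
  then have i: "i < j" "xs ! i \<in> A \<union> B" by (auto simp: I_def)
  have between: "xs ! p \<notin> A \<union> B" if "i < p" "p < j" for p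
  proof
    assume "xs ! p \<in> A \<union> B"
    then have "p \<le> i" unfolding i_def using I(1) that by (intro Max_ge) (auto simp: I_def)
    then show False using that by simp
  qed
  have pari: "xs ! i \<in> A \<longleftrightarrow> even i" using least[OF i(1)] i(2) by (auto simp: wrong_def)
  have parj: "xs ! j \<in> A \<longleftrightarrow> odd j" "xs ! j \<in> A \<union> B" using j by (auto simp: wrong_def)
  \<comment> \<open>Otherwise the edge from \<open>i\<close> to \<open>j\<close> would lie inside
    \<open>A\<close> or inside \<open>B\<close>.\<close>
  have "j \<noteq> Suc i"
  proof
    assume ji: "j = Suc i"
    then have "{xs ! i, xs ! j} \<in> E" using is_path_nth[OF xs(1), of i] xs(3) j(2) by simp
    moreover have "xs ! i \<in> A \<longleftrightarrow> xs ! j \<in> A" using pari parj ji by simp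
    ultimately show False using indA indB i(2) parj(2) by blast
  qed
  define s where "s = j - i - 1"
  have s: "s > 0" "j = i + s + 1" using \<open>j \<noteq> Suc i\<close> i(1) by (auto simp: s_def)
  define ys where "ys = take s (drop (Suc i) xs)"
  have len: "length ys = s" using xs(3) j(2) s by (simp add: ys_def)
  have nth: "ys ! p = xs ! (Suc i + p)" if "p < s" for p
    using that xs(3) j(2) s by (simp add: ys_def)
  have ys_ne: "ys \<noteq> []" using len s by auto
  have ys_hd: "hd ys = xs ! Suc i" using ys_ne nth[of 0] s by (simp add: hd_conv_nth)
  have ys_last: "last ys = xs ! (i + s)" using ys_ne nth[of "s - 1"] s len by (simp add: last_conv_nth)
  have notin: "xs ! p \<notin> set ys" if "p = i \<or> p = j" for p
  proof
    assume "xs ! p \<in> set ys"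
    then obtain q where "q < s" "xs ! p = xs ! (Suc i + q)" using len nth by (metis in_set_conv_nth)
    then show False using dist[of p "Suc i + q"] that j(2) s by auto
  qed
  have "\<not> s + 2 \<le> 2 * k"
  proof
    assume small: "s + 2 \<le> 2 * k"
    have "(xs ! i \<in> A \<longleftrightarrow> xs ! j \<in> A) \<longleftrightarrow> odd (length ys)"
    proof (rule no_odd_detour[OF free assms(2) linked])
      show "is_path E ys" unfolding ys_def by (rule is_path_sublist[OF xs(1)])
      have "set ys \<subseteq> set xs" unfolding ys_def by (meson order_trans set_drop_subset set_take_subset)
      then show "set ys \<subseteq> V" using xs(2) by blast
      show "length ys + 2 \<le> 2 * k" using small len by simp
      show "xs ! i \<noteq> xs ! j" using dist[of i j] i(1) j(2) by simp
      show "{xs ! i, hd ys} \<in> E" using is_path_nth[OF xs(1), of i] xs(3) j(2) s ys_hd by simp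
      show "{last ys, xs ! j} \<in> E"
        using is_path_nth[OF xs(1), of "i + s"] xs(3) j(2) s ys_last by simp
    qed (use ys_ne notin i(2) parj in auto)
    then show False using pari parj(1) s(2) len by auto
  qed
  \<comment> \<open>The excursion has at least \<open>2 * k - 1\<close> vertices strictly between
    \<open>i\<close> and \<open>j \<le> 2 * k\<close>, so it fills the path.\<close>
  then have "i = 0" "j = 2 * k" using s j(2) by auto
  then show ?thesis using between[of l] l by simp
qed

text \<open>This gives the dichotomy for the final deletion: either \<open>t\<close> has few
  neighbours in \<open>B\<close>, and \<open>b\<close> is one of them, or these neighbours show that
  \<open>a\<close> has many non-neighbours in \<open>B\<close>.\<close>

lemma nonadjacent_witness:
  assumes max: "maximal_cycle_free (2 * k + 1) V E" and "k \<ge> 2"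
    and linked: "well_linked E (2 * k + 2) A B" "A \<union> B \<subseteq> V"
    and indA: "\<And>a a'. a \<in> A \<Longrightarrow> a' \<in> A \<Longrightarrow> {a, a'} \<notin> E"
    and indB: "\<And>b b'. b \<in> B \<Longrightarrow> b' \<in> B \<Longrightarrow> {b, b'} \<notin> E"
    and ab: "a \<in> A" "b \<in> B" "{a, b} \<notin> E"
  obtains t where "t \<in> V - (A \<union> B)" "b \<in> nbrs E t B" "nbrs E t B \<inter> nbrs E a B = {}"
proof -
  have free: "\<not> contains_cycle (2 * k + 1) V E" using max by (simp add: maximal_cycle_free_def)
  have disj: "A \<inter> B = {}" using linked by (simp add: well_linked_def)
  then have "a \<noteq> b" using ab by auto
  then have "{a, b} \<in> [V]\<^bsup>2\<^esup> - E" using ab linked(2) by auto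
  then have "contains_cycle (2 * k + 1) V (insert {a, b} E)"
    using max by (simp add: maximal_cycle_free_def)
  then obtain xs where xs: "is_path E xs" "set xs \<subseteq> V" "length xs = 2 * k + 1" "hd xs = a" "last xs = b"
    using contains_cycle_insert_edgeE[OF _ free] assms(2) by auto
  have avoid: "xs ! l \<notin> A \<union> B" if "0 < l" "l < 2 * k" for l
    using odd_path_avoids_core[OF free assms(2) linked indA indB xs(1-3) _ _ that] xs ab by blast
  have ne: "xs \<noteq> []" using xs(3) by auto
  define ys where "ys = butlast xs"
  have ys: "xs = ys @ [b]" "length ys = 2 * k"
    using ne xs(3,5) by (auto simp: ys_def append_butlast_last_id)
  have ys_ne: "ys \<noteq> []" using ys(2) assms(2) by auto
  have ys_path: "is_path E ys" "{last ys, b} \<in> E" using xs(1) ys_ne by (auto simp: ys(1) is_path_append)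
  have ys_hd: "hd ys = a" using xs(4) ys ys_ne by simp
  define t where "t = last ys"
  have t: "t = xs ! (2 * k - 1)" using ys ys_ne assms(2) by (simp add: t_def last_conv_nth nth_append)
  have ys_B: "set ys \<inter> B = {}"
  proof -
    have "ys ! p \<notin> B" if "p < 2 * k" for p
    proof (cases "p = 0")
      case True
      then show ?thesis using ys_hd ys_ne ab disj by (auto simp: hd_conv_nth)
    next
      case False
      then show ?thesis using avoid[of p] that ys by (auto simp: nth_append)
    qed
    then show ?thesis using ys(2) by (auto simp: in_set_conv_nth)
  qed
  show thesis
  proof (rule that[of t])
    have "t \<in> V" using xs(2) ys ys_ne by (auto simp: t_def)
    then show "t \<in> V - (A \<union> B)" using avoid[of "2 * k - 1"] t assms(2) by auto
    show "b \<in> nbrs E t B" using ys_path(2) ab by (simp add: nbrs_def t_def)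
    show "nbrs E t B \<inter> nbrs E a B = {}"
    proof (rule ccontr)
      assume "\<not> ?thesis"
      then obtain b' where b': "b' \<in> B" "{t, b'} \<in> E" "{a, b'} \<in> E" by (auto simp: nbrs_def)
      \<comment> \<open>\<open>b'\<close> can replace \<open>b\<close>: it is not on
        \<open>ys\<close>, because \<open>a\<close> lies in \<open>A\<close> and the other vertices
        of \<open>ys\<close> lie outside the core.\<close>
      then have "is_path E (ys @ [b'])"
        using ys_path ys_B by (auto simp: is_path_append t_def)
      moreover have "{last (ys @ [b']), hd (ys @ [b'])} \<in> E"
        using b' ys_hd ys_ne by (simp add: insert_commute)
      ultimately have "contains_cycle (2 * k + 1) V E"
        using ys xs(2) b' linked(2) assms(2) by (intro contains_cycleI[of E "ys @ [b']"]) auto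
      then show False using free by simp
    qed
  qed
qed

section \<open>Edge counts of induced subgraphs\<close>

lemma card_induced_edges_remove:
  assumes "finite_simple_graph V E" "finite S"
  shows "card (induced_edges E S) \<le> card (induced_edges E (S - {v})) + card (nbrs E v S)"
proof -
  have E: "E \<subseteq> [V]\<^bsup>2\<^esup>" using assms by (simp add: finite_simple_graph_def)
  have sub: "induced_edges E S \<subseteq> induced_edges E (S - {v}) \<union> (\<lambda>u. {v, u}) ` nbrs E v S"
  proof
    fix e assume e: "e \<in> induced_edges E S"
    then have "e \<in> [V]\<^bsup>2\<^esup>" using E by (auto simp: induced_edges_def)
    then obtain x y where "e = {x, y}" by (auto elim: nsets2_E)
    then show "e \<in> induced_edges E (S - {v}) \<union> (\<lambda>u. {v, u}) ` nbrs E v S"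
      using e by (auto simp: induced_edges_def nbrs_def image_iff insert_commute)
  qed
  have "finite (induced_edges E (S - {v}))"
    using assms(2) by (auto simp: induced_edges_def intro: finite_subset[of _ "Pow S"])
  then have "card (induced_edges E S) \<le> card (induced_edges E (S - {v}) \<union> (\<lambda>u. {v, u}) ` nbrs E v S)"
    using sub assms(2) by (intro card_mono) (auto simp: finite_nbrs)
  also have "\<dots> \<le> card (induced_edges E (S - {v})) + card ((\<lambda>u. {v, u}) ` nbrs E v S)"
    by (rule card_Un_le)
  also have "\<dots> \<le> card (induced_edges E (S - {v})) + card (nbrs E v S)"
    by (intro add_left_mono card_image_le finite_nbrs assms(2))
  finally show ?thesis .
qed

text \<open>A crude bound, used to see that a vertex set spanning many edges is large.\<close>

lemma card_induced_edges_le_square: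
  assumes "finite_simple_graph V E" "finite S"
  shows "card (induced_edges E S) \<le> (card S)\<^sup>2"
proof -
  have E: "E \<subseteq> [V]\<^bsup>2\<^esup>" using assms by (simp add: finite_simple_graph_def)
  have "induced_edges E S \<subseteq> (\<lambda>(u, v). {u, v}) ` (S \<times> S)"
  proof
    fix e assume e: "e \<in> induced_edges E S"
    then have "e \<in> [V]\<^bsup>2\<^esup>" using E by (auto simp: induced_edges_def)
    then obtain x y where "e = {x, y}" by (auto elim: nsets2_E)
    then show "e \<in> (\<lambda>(u, v). {u, v}) ` (S \<times> S)" using e by (auto simp: induced_edges_def)
  qed
  then have "card (induced_edges E S) \<le> card (S \<times> S)"
    using assms(2) by (intro surj_card_le) auto
  then show ?thesis by (simp add: card_cartesian_product power2_eq_square)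
qed

text \<open>All induced edges run across, so edges and missing pairs together fit into
  \<open>A \<times> B\<close>.\<close>

lemma card_induced_edges_bipartite:
  assumes "finite_simple_graph V E" "finite A" "finite B"
    and indA: "\<And>a a'. a \<in> A \<Longrightarrow> a' \<in> A \<Longrightarrow> {a, a'} \<notin> E"
    and indB: "\<And>b b'. b \<in> B \<Longrightarrow> b' \<in> B \<Longrightarrow> {b, b'} \<notin> E"
  shows "card (induced_edges E (A \<union> B)) + (\<Sum>a\<in>A. card (B - nbrs E a B)) \<le> card A * card B"
proof -
  have E: "E \<subseteq> [V]\<^bsup>2\<^esup>" using assms by (simp add: finite_simple_graph_def)
  have "induced_edges E (A \<union> B) \<subseteq> (\<lambda>(a, b). {a, b}) ` (SIGMA a:A. nbrs E a B)"
  proof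
    fix e assume e: "e \<in> induced_edges E (A \<union> B)"
    then have "e \<in> [V]\<^bsup>2\<^esup>" using E by (auto simp: induced_edges_def)
    then obtain x y where xy: "e = {x, y}" by (auto elim: nsets2_E)
    then have "x \<in> A \<union> B" "y \<in> A \<union> B" "{x, y} \<in> E" using e by (auto simp: induced_edges_def)
    then have "x \<in> A \<and> y \<in> B \<or> x \<in> B \<and> y \<in> A" using indA indB by blast
    then show "e \<in> (\<lambda>(a, b). {a, b}) ` (SIGMA a:A. nbrs E a B)"
      using xy \<open>{x, y} \<in> E\<close> by (force simp: nbrs_def image_iff insert_commute)
  qed
  then have "card (induced_edges E (A \<union> B)) \<le> card (SIGMA a:A. nbrs E a B)"
    using assms(2,3) by (intro surj_card_le) (auto simp: finite_nbrs)
  also have "\<dots> = (\<Sum>a\<in>A. card (nbrs E a B))"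
    using assms(2,3) by (simp add: finite_nbrs)
  finally have "card (induced_edges E (A \<union> B)) + (\<Sum>a\<in>A. card (B - nbrs E a B))
      \<le> (\<Sum>a\<in>A. card (nbrs E a B) + card (B - nbrs E a B))"
    by (simp add: sum.distrib)
  also have "\<dots> = (\<Sum>a\<in>A. card B)"
  proof (rule sum.cong)
    fix a
    have "card (B - nbrs E a B) = card B - card (nbrs E a B)"
      using assms(3) by (intro card_Diff_subset) (auto simp: nbrs_def)
    moreover have "card (nbrs E a B) \<le> card B" using assms(3) by (intro card_mono) (auto simp: nbrs_def)
    ultimately show "card (nbrs E a B) + card (B - nbrs E a B) = card B" by simp
  qed simp
  finally show ?thesis by simp
qed

section \<open>A dense bipartite core\<close>

lemma dense_core:
  fixes x :: real
  assumes graph: "finite_simple_graph V E" and free: "\<not> contains_cycle (2 * k + 1) V E"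
    and "k \<ge> 2" and large: "card V \<ge> 2000000 * k"
    and edges: "real (card E) \<ge> (real (card V))\<^sup>2 / 4 - x" and x: "x \<le> (real (card V))\<^sup>2 / 8000"
  obtains A B where "A \<union> B \<subseteq> V" "well_linked E (2 * k + 2) A B"
    "\<And>a a'. a \<in> A \<Longrightarrow> a' \<in> A \<Longrightarrow> {a, a'} \<notin> E"
    "\<And>b b'. b \<in> B \<Longrightarrow> b' \<in> B \<Longrightarrow> {b, b'} \<notin> E"
    "12 * card (A \<union> B) \<le> 25 * card A" "12 * card (A \<union> B) \<le> 25 * card B"
    "real (card (V - (A \<union> B))) * real (card V) \<le> 200 * x"
    "real (\<Sum>a\<in>A. card (B - nbrs E a B)) \<le> x"
proof -
  define N where "N = real (card V)"
  have N: "N \<ge> 4000000" "N \<ge> 2000000 * real k"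
    using large assms(3) by (auto simp: N_def)
  have finV: "finite V" and E2: "E \<subseteq> [V]\<^bsup>2\<^esup>" using graph by (auto simp: finite_simple_graph_def)
  have loopless: "{v} \<notin> E" for v using E2 by (auto simp: nsets_def)
  \<comment> \<open>The coefficient 49/200 is a compromise: its double 49/100 exceeds the degree
    ratio 12/25 needed for bipartiteness, while its distance 1/200 to 1/4 makes
    \<open>\<Phi> V\<close> large and accounts for the factor 200 in the conclusion.\<close>
  define \<Phi> where "\<Phi> S = real (card (induced_edges E S)) - 49/200 * (real (card S))\<^sup>2" for S
  define M where "M = Max (\<Phi> ` Pow V)"
  have "M \<in> \<Phi> ` Pow V" unfolding M_def using finV by (intro Max_in) auto
  then obtain S where S: "S \<subseteq> V" "\<Phi> S = M" by auto
  have max: "\<Phi> S' \<le> \<Phi> S" if "S' \<subseteq> V" for S'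
    unfolding S(2) M_def using that finV by (intro Max_ge) auto
  have finS: "finite S" using S(1) finV by (rule finite_subset)
  define m where "m = real (card S)"
  have mN: "m \<le> N" using card_mono[OF finV S(1)] by (simp add: m_def N_def)
  have "induced_edges E V = E" using E2 by (auto simp: induced_edges_def nsets_def)
  then have "\<Phi> V \<ge> N\<^sup>2 / 4 - x - 49/200 * N\<^sup>2" using edges by (simp add: \<Phi>_def N_def)
  then have eS: "real (card (induced_edges E S)) \<ge> N\<^sup>2 / 200 - x + 49/200 * m\<^sup>2"
    using max[of V] by (simp add: \<Phi>_def m_def)
  have "real (card (induced_edges E S)) \<le> m\<^sup>2"
    using card_induced_edges_le_square[OF graph finS] unfolding m_def
    by (metis of_nat_le_iff of_nat_power)
  \<comment> \<open>Since \<open>x\<close> is at most \<open>N\<^sup>2 / 8000\<close>, the lower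
    bound on the edges of \<open>S\<close> exceeds \<open>N\<^sup>2 / 400\<close>.\<close>
  then have "(N / 20)\<^sup>2 \<le> m\<^sup>2" using eS x unfolding N_def[symmetric] by (simp add: power_divide)
  then have m: "m \<ge> N / 20" by (rule power2_le_imp_le) (simp add: m_def)
  have largeS: "card S \<ge> 100000 * k" using m N by (simp add: m_def)
  have deg: "12 * card S \<le> 25 * card (nbrs E v S)" if "v \<in> S" for v
  proof -
    have "\<Phi> (S - {v}) \<le> \<Phi> S" using max[of "S - {v}"] S(1) by auto
    moreover have "real (card (S - {v})) = m - 1"
      using that finS card_gt_0_iff[of S] by (auto simp: m_def of_nat_diff)
    moreover have "real (card (induced_edges E S)) \<le>
        real (card (induced_edges E (S - {v}))) + real (card (nbrs E v S))"
      using card_induced_edges_remove[OF graph finS, of v] by linarith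
    ultimately have "real (card (nbrs E v S)) \<ge> 49/200 * (m\<^sup>2 - (m - 1)\<^sup>2)"
      by (simp add: \<Phi>_def m_def[symmetric] algebra_simps)
    also have "49/200 * (m\<^sup>2 - (m - 1)\<^sup>2) = 49/100 * m - 49/200"
      by (simp add: power2_eq_square field_simps)
    \<comment> \<open>The surplus \<open>m / 100\<close> of 49/100 over 12/25 absorbs the constant
      49/200.\<close>
    finally have "25 * real (card (nbrs E v S)) \<ge> 12 * m" using m N by simp
    then show ?thesis by (simp add: m_def)
  qed
  obtain A B where AB: "A \<union> B = S" "A \<inter> B = {}"
    and indA: "\<And>a a'. a \<in> A \<Longrightarrow> a' \<in> A \<Longrightarrow> {a, a'} \<notin> E"
    and indB: "\<And>b b'. b \<in> B \<Longrightarrow> b' \<in> B \<Longrightarrow> {b, b'} \<notin> E"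
    using bipartite_of_min_degree[OF free assms(3) loopless finS S(1) largeS deg] by blast
  have fin: "finite A" "finite B" using AB(1) finS by auto
  have "nbrs E a S = nbrs E a B" if "a \<in> A" for a
    using indA that AB(1) by (auto simp: nbrs_def)
  then have degA: "12 * card S \<le> 25 * card (nbrs E a B)" if "a \<in> A" for a
    using deg[of a] that AB(1) by auto
  have "nbrs E b S = nbrs E b A" if "b \<in> B" for b
    using indB that AB(1) by (auto simp: nbrs_def)
  then have degB: "12 * card S \<le> 25 * card (nbrs E b A)" if "b \<in> B" for b
    using deg[of b] that AB(1) by auto
  have pos: "card S > 0" using largeS assms(3) by simp
  have nbrsB: "card (nbrs E v B) \<le> card B" for v using fin nbrs_subset by (intro card_mono)
  have nbrsA: "card (nbrs E v A) \<le> card A" for v using fin nbrs_subset by (intro card_mono)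
  have "S \<noteq> {}" using pos by auto
  have "A \<noteq> {}"
  proof
    assume "A = {}"
    then obtain b where "b \<in> B" using AB(1) \<open>S \<noteq> {}\<close> by auto
    then show False using degB[of b] nbrsA[of b] \<open>A = {}\<close> pos by simp
  qed
  then have cB: "12 * card S \<le> 25 * card B" using degA nbrsB by (meson all_not_in_conv le_trans mult_le_mono2)
  then have "B \<noteq> {}" using pos by auto
  then have cA: "12 * card S \<le> 25 * card A" using degB nbrsA by (meson all_not_in_conv le_trans mult_le_mono2)
  have cS: "card A + card B = card S" using AB fin card_Un_disjoint by metis
  \<comment> \<open>Two neighbourhoods of relative size 12/25 in a part of relative size at most
    13/25 overlap in at least 11/25 of \<open>card S\<close>.\<close>
  have common: "2 * k + 2 \<le> card (nbrs E u P \<inter> nbrs E w P)"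
    if "finite P" "12 * card S \<le> 25 * card (nbrs E u P)" "12 * card S \<le> 25 * card (nbrs E w P)"
      "25 * card P \<le> 13 * card S" for u w P
  proof -
    have "card (nbrs E u P) + card (nbrs E w P) =
        card (nbrs E u P \<union> nbrs E w P) + card (nbrs E u P \<inter> nbrs E w P)"
      using that(1) by (intro card_Un_Int) (auto simp: finite_nbrs)
    moreover have "card (nbrs E u P \<union> nbrs E w P) \<le> card P"
      using that(1) by (intro card_mono) (auto simp: nbrs_def)
    ultimately show ?thesis using that largeS assms(3) by linarith
  qed
  have "25 * card A \<le> 13 * card S" "25 * card B \<le> 13 * card S" using cA cB cS by auto
  then have linked: "well_linked E (2 * k + 2) A B"
    unfolding well_linked_def using common fin degA degB AB(2) by auto
  define D where "D = real (\<Sum>a\<in>A. card (B - nbrs E a B))"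
  have "real (card (induced_edges E S)) + D \<le> real (card A) * real (card B)"
    using card_induced_edges_bipartite[OF graph fin indA indB] unfolding AB(1) D_def
    by (metis of_nat_add of_nat_le_iff of_nat_mult)
  also have "\<dots> \<le> m\<^sup>2 / 4"
  proof -
    have "m = real (card A) + real (card B)" using cS by (simp add: m_def)
    then show ?thesis
      using sum_squares_bound[of "real (card A)" "real (card B)"]
      by (simp add: power2_eq_square algebra_simps)
  qed
  \<comment> \<open>The upper bound \<open>m\<^sup>2 / 4 - D\<close> meets the lower bound from
    \<open>\<Phi> V\<close>. One inequality thus controls both the vertices lost and the missing
    pairs.\<close>
  finally have D: "N\<^sup>2 - m\<^sup>2 + 200 * D \<le> 200 * x" using eS by (simp add: field_simps)
  have sq: "(N - m) * N \<le> N\<^sup>2 - m\<^sup>2"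
  proof -
    have "0 \<le> (N - m) * m" using mN by (simp add: m_def)
    then show ?thesis by (simp add: power2_eq_square algebra_simps)
  qed
  have D0: "D \<ge> 0" unfolding D_def by (rule of_nat_0_le_iff)
  have "0 \<le> (N - m) * N" using mN N by simp
  then have Dx: "D \<le> x" using D sq by linarith
  have "real (card (V - S)) = N - m"
    using card_Diff_subset[OF finS S(1)] card_mono[OF finV S(1)] by (simp add: N_def m_def of_nat_diff)
  then have "real (card (V - S)) * N \<le> 200 * x" using D sq D0 by simp
  then show thesis
    using that[of A B] S(1) linked indA indB cA cB Dx unfolding AB(1) N_def D_def by blast
qed

section \<open>Trimming the core to a complete bipartite graph\<close>

theorem theorem3p1:
  fixes V :: "'a set" and E :: "'a set set" and k n :: nat and \<epsilon> :: real
  assumes "k \<ge> 2"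
    and "n \<ge> (2 * k) ^ (9 * k\<^sup>2)"
    and "0 < \<epsilon>" and "\<epsilon> < 1 / (2000 * (real k)\<^sup>2)"
    and "finite_simple_graph V E"
    and "card V = n"
    and "maximal_cycle_free (2 * k + 1) V E"
    and "real (card E) = (real n)\<^sup>2 / 4 - \<epsilon> * real n powr (3 / 2)"
  shows "\<exists>W \<subseteq> V. complete_bipartite W (induced_edges E W) \<and>
           real (card W) \<ge> (1 - 250 * (real k)\<^sup>2 * \<epsilon>) * real n"
proof -
  have free: "\<not> contains_cycle (2 * k + 1) V E"
    using assms(7) by (simp add: maximal_cycle_free_def)
  have finV: "finite V" using assms(5) by (simp add: finite_simple_graph_def)
  have k4: "(real k)\<^sup>2 \<ge> 4" using power_mono[of 2 "real k" 2] assms(1) by simp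
  \<comment> \<open>The exponent is at least 13 and \<open>4 ^ 12\<close> exceeds 2000000.\<close>
  have large: "n \<ge> 2000000 * k"
  proof -
    have "k\<^sup>2 \<ge> 4" using power_mono[of 2 k 2] assms(1) by simp
    have "4 ^ 12 * k \<le> (2 * k) ^ 12 * (2 * k)"
      using power_mono[of 4 "2 * k" 12] assms(1) by (intro mult_mono) auto
    also have "\<dots> = (2 * k) ^ 13" by (simp flip: power_Suc2)
    also have "\<dots> \<le> (2 * k) ^ (9 * k\<^sup>2)"
      using \<open>k\<^sup>2 \<ge> 4\<close> assms(1) by (intro power_increasing) auto
    finally show ?thesis using assms(2) by simp
  qed
  define r where "r = sqrt (real n)"
  have r2: "r\<^sup>2 = real n" by (simp add: r_def)
  have "real n \<ge> 1" using large assms(1) by simp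
  then have r1: "r \<ge> 1" by (simp add: r_def)
  have eps: "\<epsilon> < 1 / 8000"
  proof -
    have "1 / (2000 * (real k)\<^sup>2) \<le> 1 / (2000 * 4)" using k4 assms(1) by (intro divide_left_mono) auto
    then show ?thesis using assms(4) by simp
  qed
  define x where "x = \<epsilon> * r ^ 3"
  have "real n powr (3 / 2) = r ^ 3"
  proof -
    have "real n powr (3 / 2) = (real n powr (1 / 2)) powr 3" by (simp add: powr_powr)
    also have "\<dots> = r ^ 3" using r1 by (simp add: powr_half_sqrt powr_numeral r_def)
    finally show ?thesis .
  qed
  then have edges: "real (card E) = (real (card V))\<^sup>2 / 4 - x" using assms(6,8) by (simp add: x_def)
  have x: "x \<le> (real (card V))\<^sup>2 / 8000"
  proof -
    have "r ^ 3 \<le> r ^ 4" using r1 by (intro power_increasing) auto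
    then have "x \<le> 1 / 8000 * r ^ 4" unfolding x_def using eps assms(3) r1 by (intro mult_mono) auto
    also have "r ^ 4 = (real (card V))\<^sup>2" unfolding assms(6) r2[symmetric] by simp
    finally show ?thesis by simp
  qed
  obtain A B where sub: "A \<union> B \<subseteq> V" and linked: "well_linked E (2 * k + 2) A B"
    and indA: "\<And>a a'. a \<in> A \<Longrightarrow> a' \<in> A \<Longrightarrow> {a, a'} \<notin> E"
    and indB: "\<And>b b'. b \<in> B \<Longrightarrow> b' \<in> B \<Longrightarrow> {b, b'} \<notin> E"
    and cA: "12 * card (A \<union> B) \<le> 25 * card A" and cB: "12 * card (A \<union> B) \<le> 25 * card B"
    and T: "real (card (V - (A \<union> B))) * real (card V) \<le> 200 * x"
    and D: "real (\<Sum>a\<in>A. card (B - nbrs E a B)) \<le> x"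
    using dense_core[OF assms(5) free assms(1) _ _ x] large edges assms(6) by auto
  have disj: "A \<inter> B = {}" using linked by (simp add: well_linked_def)
  have fin: "finite A" "finite B" using sub finV by (auto intro: finite_subset)
  define t where "t = real (card (V - (A \<union> B)))"
  have t: "t \<le> 200 * \<epsilon> * r"
  proof -
    have "t * r\<^sup>2 \<le> (200 * \<epsilon> * r) * r\<^sup>2"
      using T unfolding assms(6) t_def[symmetric] r2[symmetric] x_def
      by (simp add: power2_eq_square power3_eq_cube mult_ac)
    then show ?thesis using r1 by (simp add: mult_le_cancel_right)
  qed
  \<comment> \<open>The threshold \<open>r\<close>, the square root of \<open>n\<close>, balances
    two costs: at most \<open>200 * \<epsilon> * r\<close> outside vertices remove up to
    \<open>r\<close> vertices of \<open>B\<close> each, and by Markov at most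
    \<open>x / r = \<epsilon> * n\<close> vertices of \<open>A\<close> have more than
    \<open>r\<close> non-neighbours.\<close>
  define few where "few = {s \<in> V - (A \<union> B). real (card (nbrs E s B)) \<le> r}"
  define C where "C = (\<Union>s\<in>few. nbrs E s B)"
  define A' where "A' = {a \<in> A. real (card (B - nbrs E a B)) > r}"
  have finf: "finite few" using finV by (simp add: few_def)
  have C: "real (card C) \<le> 200 * \<epsilon> * real n"
  proof -
    have "real (card C) \<le> real (\<Sum>s\<in>few. card (nbrs E s B))"
      unfolding C_def using card_UN_le[OF finf] by (intro of_nat_mono)
    also have "\<dots> \<le> (\<Sum>s\<in>few. r)" unfolding of_nat_sum by (rule sum_mono) (simp add: few_def)
    also have "\<dots> = real (card few) * r" by simp
    also have "\<dots> \<le> t * r"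
      unfolding t_def using r1 finV by (intro mult_right_mono of_nat_mono card_mono) (auto simp: few_def)
    also have "\<dots> \<le> 200 * \<epsilon> * r * r" using t r1 by (intro mult_right_mono) auto
    also have "\<dots> = 200 * \<epsilon> * real n" by (simp flip: r2 add: power2_eq_square)
    finally show ?thesis .
  qed
  have A': "real (card A') \<le> \<epsilon> * real n"
  proof -
    have "real (card A') * r = (\<Sum>a\<in>A'. r)" by simp
    also have "\<dots> \<le> (\<Sum>a\<in>A'. real (card (B - nbrs E a B)))" by (rule sum_mono) (simp add: A'_def)
    also have "\<dots> \<le> (\<Sum>a\<in>A. real (card (B - nbrs E a B)))"
      using fin by (intro sum_mono2) (auto simp: A'_def)
    also have "\<dots> \<le> x" using D by simp
    also have "x = (\<epsilon> * real n) * r"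
      unfolding x_def r2[symmetric] by (simp add: power2_eq_square power3_eq_cube)
    finally show ?thesis using r1 by simp
  qed
  have en: "0 \<le> \<epsilon> * real n" "\<epsilon> * real n \<le> real n / 8000"
    using assms(3) eps mult_right_mono[of \<epsilon> "1 / 8000" "real n"] by auto
  have rn: "200 * \<epsilon> * r \<le> 200 * (\<epsilon> * real n)"
  proof -
    have "r \<le> r\<^sup>2" using r1 by (simp add: power2_eq_square)
    then show ?thesis unfolding r2 using assms(3) by simp
  qed
  have core: "real (card (A \<union> B)) = real n - t"
  proof -
    have "card (V - (A \<union> B)) = card V - card (A \<union> B)" "card (A \<union> B) \<le> card V"
      using sub fin finV by (auto intro: card_Diff_subset card_mono)
    then show ?thesis using assms(6) by (simp add: t_def of_nat_diff)
  qed
  have cAB: "card (A \<union> B) = card A + card B" using fin disj by (intro card_Un_disjoint)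
  have subC: "C \<subseteq> B" and subA': "A' \<subseteq> A" by (auto simp: C_def A'_def nbrs_def)
  have cAA': "real (card (A - A')) = real (card A) - real (card A')"
    using subA' fin card_mono[OF fin(1) subA']
    by (simp add: card_Diff_subset finite_subset[OF subA'] of_nat_diff)
  have cBC: "real (card (B - C)) = real (card B) - real (card C)"
    using subC fin card_mono[OF fin(2) subC]
    by (simp add: card_Diff_subset finite_subset[OF subC] of_nat_diff)
  have core2: "12 * real (card (A \<union> B)) \<le> 25 * real (card A)" "12 * real (card (A \<union> B)) \<le> 25 * real (card B)"
    using cA cB by linarith+
  \<comment> \<open>As \<open>\<epsilon> < 1 / 8000\<close>, each of \<open>t\<close>,
    \<open>card C\<close> and \<open>card A'\<close> is at most \<open>n / 40\<close>, while each
    part holds at least 12/25 of the core.\<close>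
  have "real (card (A - A')) > 0" "real (card (B - C)) > 0"
    unfolding cAA' cBC using core2 core t rn en A' C \<open>real n \<ge> 1\<close> by linarith+
  then have ne: "A - A' \<noteq> {}" "B - C \<noteq> {}" by force+
  have adj: "{a, b} \<in> E" if ab: "a \<in> A - A'" "b \<in> B - C" for a b
  proof (rule ccontr)
    assume "{a, b} \<notin> E"
    then obtain s where s: "s \<in> V - (A \<union> B)" "b \<in> nbrs E s B" "nbrs E s B \<inter> nbrs E a B = {}"
      using nonadjacent_witness[OF assms(7,1) linked sub indA indB] ab by blast
    \<comment> \<open>Since \<open>b\<close> survived, \<open>s\<close> has more than
      \<open>r\<close> neighbours in \<open>B\<close>; none is adjacent to \<open>a\<close>, so
      \<open>a\<close> should have been deleted.\<close>
    have "s \<notin> few" using ab s(2) by (auto simp: C_def)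
    then have "r < real (card (nbrs E s B))" using s(1) by (auto simp: few_def)
    also have "\<dots> \<le> real (card (B - nbrs E a B))"
      using s(3) fin(2) by (intro of_nat_mono card_mono) (auto simp: nbrs_def)
    finally show False using ab by (auto simp: A'_def)
  qed
  define W where "W = (A - A') \<union> (B - C)"
  have "induced_edges E W = {{a, b} | a b. a \<in> A - A' \<and> b \<in> B - C}"
  proof (intro equalityI subsetI)
    fix e assume e: "e \<in> induced_edges E W"
    then have "e \<in> [V]\<^bsup>2\<^esup>" using assms(5) by (auto simp: induced_edges_def finite_simple_graph_def)
    then obtain p q where pq: "e = {p, q}" by (auto elim: nsets2_E)
    then have "p \<in> W" "q \<in> W" "{p, q} \<in> E" using e by (auto simp: induced_edges_def)
    then have "p \<in> A - A' \<and> q \<in> B - C \<or> q \<in> A - A' \<and> p \<in> B - C"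
      unfolding W_def using indA indB by blast
    then show "e \<in> {{a, b} | a b. a \<in> A - A' \<and> b \<in> B - C}"
      using pq by (auto simp: insert_commute)
  qed (use adj in \<open>auto simp: induced_edges_def W_def\<close>)
  then have cb: "complete_bipartite W (induced_edges E W)"
    unfolding complete_bipartite_def using ne disj
    by (intro exI[of _ "A - A'"] exI[of _ "B - C"]) (auto simp: W_def)
  have "card W = card (A - A') + card (B - C)"
    unfolding W_def using fin disj by (intro card_Un_disjoint) auto
  \<comment> \<open>The 401 is 200 for vertices outside the core, 200 for \<open>C\<close> and 1 for
    \<open>A'\<close>. It is below \<open>250 * k\<^sup>2\<close>, which is at least 1000.\<close>
  then have "real (card W) \<ge> real n - 401 * (\<epsilon> * real n)"
    using cAA' cBC core cAB t rn A' C by simp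
  moreover have "1000 * (\<epsilon> * real n) \<le> 250 * (real k)\<^sup>2 * (\<epsilon> * real n)"
    using k4 en by (intro mult_right_mono) auto
  ultimately have "real (card W) \<ge> (1 - 250 * (real k)\<^sup>2 * \<epsilon>) * real n"
    using en by (simp add: algebra_simps)
  moreover have "W \<subseteq> V" using sub by (auto simp: W_def)
  ultimately show ?thesis using cb by blast
qed

end
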